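(* Let $M$ and $N$ be two weighted means (of the same direction), let $I\subseteq(0,\infty)$ and $J\subseteq(0,\infty)$ be intervals, and let $f:I\to J$ be $MN$-convex. Then for all $u,v\in I$ with $u<v$, $$f\big(M(u,v,1/2)\big)\le\int_0^1 N\Big(f\big(M(u,v,\lambda)\big),f\big(M(u,v,1-\lambda)\big),1/2\Big)\,d\lambda\le N\big(f(u),f(v),1/2\big).$$
   Context: A function $M:(0,\infty)\times(0,\infty)\times[0,1]\to(0,\infty)$ is called a weighted mean if the following hold. (WM1) $M(u,v,\lambda)=M(v,u,1-\lambda)$. (WM2) $M(u,u,\lambda)=u$. (WM3) $u<M(u,v,\lambda)<v$ whenever $u<v$ and $\lambda\in(0,1)$. (WM4) $M(\alpha u,\alpha v,\lambda)=\alpha M(u,v,\lambda)$ for all $\alpha>0$. (WM5) For fixed $\lambda\in[0,1]$: $M(u,v,\lambda)\le M(w,v,\lambda)$ whenever $u\le w$, and $M(u,v,\lambda)\le M(u,w,\lambda)$ whenever $v\le w$. (WM6) For fixed $u\ne v$, $M(u,v,\cdot)$ is strictly monotone and continuous on $[0,1]$ with range $[\min\{u,v\},\max\{u,v\}]$. Moreover $M$ has a direction: either $M(u,v,\cdot)$ is strictly increasing for all $u<v$ (positive direction; then $M(u,v,0)=u$, $M(u,v,1)=v$ for all $u,v$), or $M(u,v,\cdot)$ is strictly decreasing for all $u<v$ (negative direction; then $M(u,v,0)=v$, $M(u,v,1)=u$ for all $u,v$). (WM7) $M(M(u,v,\lambda),M(z,w,\lambda),s)=M(M(u,z,s),M(v,w,s),\lambda)$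 for all $u,v,z,w>0$, $s,\lambda\in[0,1]$. (WM8) For all $u,v>0$, $s,\lambda_1,\lambda_2\in[0,1]$: $M(M(u,v,\lambda_1),M(u,v,\lambda_2),s)$ equals $M(u,v,s\lambda_1+(1-s)\lambda_2)$ if $M$ has negative direction, and $M(u,v,(1-s)\lambda_1+s\lambda_2)$ if $M$ has positive direction. Standing assumption: all weighted means occurring together have the same direction. For weighted means $M,N$ and intervals $I,J\subseteq(0,\infty)$, a function $f:I\to J$ is $MN$-convex if $f(M(u,v,\lambda))\le N(f(u),f(v),\lambda)$ for all $u,v\in I$, $\lambda\in[0,1]$. *)

theory Defs
  imports "HOL-Analysis.Analysis"
begin

text \<open>
  A weighted mean is a function \<open>(0,\<infinity>) \<times> (0,\<infinity>) \<times> [0,1] \<rightarrow> (0,\<infinity>)\<close>. It is represented by a total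
  curried function on the reals; every condition below is relativised to that domain, and nothing is
  assumed about values outside it.
\<close>

definition positive_direction :: "(real \<Rightarrow> real \<Rightarrow> real \<Rightarrow> real) \<Rightarrow> bool" where
  "positive_direction M \<longleftrightarrow> (\<forall>u v. 0 < u \<and> u < v \<longrightarrow> strict_mono_on {0..1} (M u v))"

definition negative_direction :: "(real \<Rightarrow> real \<Rightarrow> real \<Rightarrow> real) \<Rightarrow> bool" where
  "negative_direction M \<longleftrightarrow> (\<forall>u v. 0 < u \<and> u < v \<longrightarrow> strict_antimono_on {0..1} (M u v))"

definition same_direction ::
  "(real \<Rightarrow> real \<Rightarrow> real \<Rightarrow> real) \<Rightarrow> (real \<Rightarrow> real \<Rightarrow> real \<Rightarrow> real) \<Rightarrow> bool" where
  "same_direction M N \<longleftrightarrow>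
     (positive_direction M \<and> positive_direction N) \<or>
     (negative_direction M \<and> negative_direction N)"

locale weighted_mean =
  fixes M :: "real \<Rightarrow> real \<Rightarrow> real \<Rightarrow> real"
  assumes pos: "\<lbrakk>0 < u; 0 < v; l \<in> {0..1}\<rbrakk> \<Longrightarrow> 0 < M u v l"
    and WM1: "\<lbrakk>0 < u; 0 < v; l \<in> {0..1}\<rbrakk> \<Longrightarrow> M u v l = M v u (1 - l)"
    and WM2: "\<lbrakk>0 < u; l \<in> {0..1}\<rbrakk> \<Longrightarrow> M u u l = u"
    and WM3: "\<lbrakk>0 < u; u < v; l \<in> {0<..<1}\<rbrakk> \<Longrightarrow> u < M u v l \<and> M u v l < v"
    and WM4: "\<lbrakk>0 < u; 0 < v; l \<in> {0..1}; 0 < a\<rbrakk> \<Longrightarrow> M (a * u) (a * v) l = a * M u v l"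
    and WM5_left: "\<lbrakk>0 < u; 0 < v; 0 < w; l \<in> {0..1}; u \<le> w\<rbrakk> \<Longrightarrow> M u v l \<le> M w v l"
    and WM5_right: "\<lbrakk>0 < u; 0 < v; 0 < w; l \<in> {0..1}; v \<le> w\<rbrakk> \<Longrightarrow> M u v l \<le> M u w l"
    and WM6_strict: "\<lbrakk>0 < u; 0 < v; u \<noteq> v\<rbrakk> \<Longrightarrow>
      strict_mono_on {0..1} (M u v) \<or> strict_antimono_on {0..1} (M u v)"
    and WM6_continuous: "\<lbrakk>0 < u; 0 < v; u \<noteq> v\<rbrakk> \<Longrightarrow> continuous_on {0..1} (M u v)"
    and WM6_range: "\<lbrakk>0 < u; 0 < v; u \<noteq> v\<rbrakk> \<Longrightarrow> M u v ` {0..1} = {min u v..max u v}"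
    and WM6_direction: "positive_direction M \<or> negative_direction M"
    and WM7: "\<lbrakk>0 < u; 0 < v; 0 < z; 0 < w; s \<in> {0..1}; l \<in> {0..1}\<rbrakk> \<Longrightarrow>
      M (M u v l) (M z w l) s = M (M u z s) (M v w s) l"
    and WM8_negative: "\<lbrakk>negative_direction M; 0 < u; 0 < v; s \<in> {0..1}; l1 \<in> {0..1}; l2 \<in> {0..1}\<rbrakk> \<Longrightarrow>
      M (M u v l1) (M u v l2) s = M u v (s * l1 + (1 - s) * l2)"
    and WM8_positive: "\<lbrakk>positive_direction M; 0 < u; 0 < v; s \<in> {0..1}; l1 \<in> {0..1}; l2 \<in> {0..1}\<rbrakk> \<Longrightarrow>
      M (M u v l1) (M u v l2) s = M u v ((1 - s) * l1 + s * l2)"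
begin

text \<open>The endpoint values belonging to a direction follow from the remaining conditions.\<close>

lemma positive_direction_endpoints:
  assumes "positive_direction M" "0 < u" "0 < v"
  shows "M u v 0 = u \<and> M u v 1 = v"
proof -
  have less: "M a b 0 = a \<and> M a b 1 = b" if ab: "0 < a" "a < b" for a b
  proof -
    have mono: "M a b x \<le> M a b y" if "x \<in> {0..1}" "y \<in> {0..1}" "x \<le> y" for x y
      using assms(1) ab that strict_mono_on_leD[of "{0..1}" "M a b" x y]
      unfolding positive_direction_def by blast
    have rng: "M a b ` {0..1} = {a..b}" using WM6_range[of a b] ab by simp
    have "a \<in> M a b ` {0..1}" "b \<in> M a b ` {0..1}" using rng ab by auto
    then obtain x y where "x \<in> {0..1}" "M a b x = a" "y \<in> {0..1}" "M a b y = b"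
      by (metis imageE)
    then have "M a b 0 \<le> a" "b \<le> M a b 1" using mono[of 0 x] mono[of y 1] by auto
    moreover have "M a b 0 \<in> {a..b}" "M a b 1 \<in> {a..b}"
      using rng image_eqI[of _ "M a b" _ "{0..1}"] by auto
    ultimately show ?thesis by auto
  qed
  consider "u < v" | "u = v" | "v < u" by linarith
  then show ?thesis
  proof cases
    case 1 then show ?thesis using less assms by blast
  next
    case 2 then show ?thesis using WM2 assms by simp
  next
    case 3 then show ?thesis using less[of v u] WM1[of u v 0] WM1[of u v 1] assms by simp
  qed
qed

lemma negative_direction_endpoints:
  assumes "negative_direction M" "0 < u" "0 < v"
  shows "M u v 0 = v \<and> M u v 1 = u"
proof -
  have less: "M a b 0 = b \<and> M a b 1 = a" if ab: "0 < a" "a < b" for a b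
  proof -
    have anti: "M a b y \<le> M a b x" if "x \<in> {0..1}" "y \<in> {0..1}" "x \<le> y" for x y
    proof (cases "x = y")
      case False
      then show ?thesis
        using assms(1) ab that unfolding negative_direction_def monotone_on_def
        by (metis less_eq_real_def)
    qed simp
    have rng: "M a b ` {0..1} = {a..b}" using WM6_range[of a b] ab by simp
    have "a \<in> M a b ` {0..1}" "b \<in> M a b ` {0..1}" using rng ab by auto
    then obtain x y where "x \<in> {0..1}" "M a b x = a" "y \<in> {0..1}" "M a b y = b"
      by (metis imageE)
    then have "M a b 1 \<le> a" "b \<le> M a b 0" using anti[of x 1] anti[of 0 y] by auto
    moreover have "M a b 0 \<in> {a..b}" "M a b 1 \<in> {a..b}"
      using rng image_eqI[of _ "M a b" _ "{0..1}"] by auto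
    ultimately show ?thesis by auto
  qed
  consider "u < v" | "u = v" | "v < u" by linarith
  then show ?thesis
  proof cases
    case 1 then show ?thesis using less assms by blast
  next
    case 2 then show ?thesis using WM2 assms by simp
  next
    case 3 then show ?thesis using less[of v u] WM1[of u v 0] WM1[of u v 1] assms by simp
  qed
qed

end

definition mn_convex_on ::
  "(real \<Rightarrow> real \<Rightarrow> real \<Rightarrow> real) \<Rightarrow> (real \<Rightarrow> real \<Rightarrow> real \<Rightarrow> real) \<Rightarrow> real set \<Rightarrow> (real \<Rightarrow> real) \<Rightarrow> bool" where
  "mn_convex_on M N I f \<longleftrightarrow>
     (\<forall>u\<in>I. \<forall>v\<in>I. \<forall>l\<in>{0..1}. f (M u v l) \<le> N (f u) (f v) l)"

end

theory Submission
  imports Defs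
begin

text \<open>
  Write \<open>h l = N (f (M u v l)) (f (M u v (1 - l))) (1/2)\<close>. Both bounds hold pointwise for \<open>h\<close>, by WM8
  for \<open>M\<close> and for \<open>N\<close> respectively. For integrability, WM8 for \<open>M\<close> and WM7 for \<open>N\<close> make \<open>h\<close> convex with
  respect to \<open>N\<close>; as \<open>h\<close> is symmetric about \<open>1/2\<close>, it increases on \<open>{1/2..1}\<close> and decreases on \<open>{0..1/2}\<close>.
\<close>

text \<open>Monotone functions on a compact interval are integrable. The reflection \<open>l\<close>
  to \<open>1 - l\<close> makes \<open>h\<close> decreasing on the left half, so the criterion is
  applied there to \<open>- h\<close>.\<close>

lemma integrable_on_symmetric_mono:
  fixes h :: "real \<Rightarrow> real"
  assumes mono: "mono_on {1/2..1} h"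
    and sym: "\<And>l. l \<in> {0..1} \<Longrightarrow> h (1 - l) = h l"
  shows "h integrable_on {0..1}"
proof (rule Henstock_Kurzweil_Integration.integrable_combine[where c = "1/2"])
  have "mono_on {0..1/2} (\<lambda>l. - h l)"
  proof (rule mono_onI)
    fix x y :: real
    assume "x \<in> {0..1/2}" "y \<in> {0..1/2}" "x \<le> y"
    then show "- h x \<le> - h y"
      using mono_onD[OF mono, of "1 - y" "1 - x"] sym[of x] sym[of y] by auto
  qed
  then show "h integrable_on {0..1/2}"
    using integrable_on_mono_on integrable_neg_iff by blast
  show "h integrable_on {1/2..1}"
    using mono by (rule integrable_on_mono_on)
qed auto

context weighted_mean
begin

lemma mono_both:
  assumes "0 < a" "0 < b" "a \<le> c" "b \<le> d" "l \<in> {0..1}"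
  shows "M a b l \<le> M c d l"
  using WM5_left[of a b c l] WM5_right[of c b d l] assms by linarith

lemma in_segment:
  assumes "0 < u" "u < v" "l \<in> {0..1}"
  shows "M u v l \<in> {u..v}"
  using WM6_range[of u v] assms by (auto simp: min_def max_def)

text \<open>A direction-free form of WM8: \<open>t\<close> is \<open>s\<close> or
  \<open>1 - s\<close> according to the direction. It is chosen before \<open>u\<close>,
  \<open>v\<close>, \<open>l1\<close>, \<open>l2\<close>, so one \<open>t\<close> serves several
  combinations at once.\<close>

lemma affine_combination:
  assumes "s \<in> {0..1}"
  obtains t where "t \<in> {0..1}"
    "\<And>u v l1 l2. \<lbrakk>0 < u; 0 < v; l1 \<in> {0..1}; l2 \<in> {0..1}\<rbrakk> \<Longrightarrow>
      M (M u v l1) (M u v l2) t = M u v ((1 - s) * l1 + s * l2)"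
  using WM6_direction
proof
  assume "positive_direction M"
  then show thesis
    using that[of s] WM8_positive assms by blast
next
  assume neg: "negative_direction M"
  show thesis
    by (rule that[of "1 - s"]) (use WM8_negative[OF neg, of _ _ "1 - s"] assms in auto)
qed

text \<open>At weight \<open>1/2\<close> the two forms of WM8 coincide, and the parameters
  \<open>l\<close> and \<open>1 - l\<close> average to \<open>1/2\<close>.\<close>

lemma midpoint:
  assumes "0 < u" "0 < v" "l \<in> {0..1}"
  shows "M (M u v l) (M u v (1 - l)) (1/2) = M u v (1/2)"
proof -
  have "M (M u v l) (M u v (1 - l)) (1/2) = M u v (l / 2 + (1 - l) / 2)"
    using WM6_direction WM8_positive[of u v "1/2" l "1 - l"] WM8_negative[of u v "1/2" l "1 - l"] assms
    by auto
  also have "l / 2 + (1 - l) / 2 = 1/2"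
    by (simp add: field_simps)
  finally show ?thesis .
qed

end

theorem theorem7:
  fixes M N :: "real \<Rightarrow> real \<Rightarrow> real \<Rightarrow> real"
    and I J :: "real set"
    and f :: "real \<Rightarrow> real"
    and u v :: real
  assumes "weighted_mean M" and "weighted_mean N" and "same_direction M N"
    and "is_interval I" and "I \<subseteq> {0<..}"
    and "is_interval J" and "J \<subseteq> {0<..}"
    and "f \<in> I \<rightarrow> J"
    and "mn_convex_on M N I f"
    and "u \<in> I" and "v \<in> I" and "u < v"
  shows "(\<lambda>l. N (f (M u v l)) (f (M u v (1 - l))) (1/2)) integrable_on {0..1}
    \<and> f (M u v (1/2)) \<le> integral {0..1} (\<lambda>l. N (f (M u v l)) (f (M u v (1 - l))) (1/2))
    \<and> integral {0..1} (\<lambda>l. N (f (M u v l)) (f (M u v (1 - l))) (1/2)) \<le> N (f u) (f v) (1/2)"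
proof -
  interpret M: weighted_mean M by fact
  interpret N: weighted_mean N by fact
  define g where "g l = f (M u v l)" for l
  define h where "h l = N (g l) (g (1 - l)) (1/2)" for l
  have u: "0 < u" and v: "0 < v"
    using assms by auto
  have M_in: "M u v l \<in> I" if "l \<in> {0..1}" for l
    using M.in_segment[of u v l] u \<open>u < v\<close> that assms
    by (meson atLeastAtMost_iff mem_is_interval_1_I)
  have f_pos: "0 < f x" if "x \<in> I" for x
    using assms that by (auto dest: funcset_mem)
  have g_pos: "0 < g l" if "l \<in> {0..1}" for l
    unfolding g_def using M_in f_pos that by blast
  have conv: "f (M x y l) \<le> N (f x) (f y) l" if "x \<in> I" "y \<in> I" "l \<in> {0..1}" for x y l
    using assms that unfolding mn_convex_on_def by blast

  have h_sym: "h (1 - l) = h l" if "l \<in> {0..1}" for l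
    unfolding h_def using N.WM1[of "g l" "g (1 - l)" "1/2"] g_pos that by simp

  have "mono_on {1/2..1} h"
  proof (rule mono_onI)
    fix x y :: real
    assume x: "x \<in> {1/2..1}" and y: "y \<in> {1/2..1}" and "x \<le> y"
    show "h x \<le> h y"
    \<comment> \<open>For \<open>y = 1/2\<close> the segment from \<open>1 - y\<close> to
      \<open>y\<close> used below shrinks to a point.\<close>
    proof (cases "y = 1/2")
      case True
      then have "x = y" using x \<open>x \<le> y\<close> by auto
      then show ?thesis by simp
    next
      case False
      then have y': "1/2 < y" using y by simp
      \<comment> \<open>The relative position of \<open>x\<close> in \<open>{1 - y..y}\<close>; by
        reflection, \<open>1 - x\<close> has the same position with the endpoints swapped.\<close>
      define s where "s = (x - (1 - y)) / (2 * y - 1)"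
      have s: "s \<in> {0..1}"
        unfolding s_def using x y' \<open>x \<le> y\<close> by (auto simp: divide_simps)
      have "s * (2 * y - 1) = x - (1 - y)"
        unfolding s_def using y' by simp
      then have comb: "(1 - s) * (1 - y) + s * y = x" "(1 - s) * y + s * (1 - y) = 1 - x"
        by (auto simp: algebra_simps)
      obtain t where t: "t \<in> {0..1}"
        and affine: "\<And>l1 l2. \<lbrakk>l1 \<in> {0..1}; l2 \<in> {0..1}\<rbrakk> \<Longrightarrow>
          M (M u v l1) (M u v l2) t = M u v ((1 - s) * l1 + s * l2)"
        using M.affine_combination[OF s] u v by metis
      have mem: "x \<in> {0..1}" "1 - x \<in> {0..1}" "y \<in> {0..1}" "1 - y \<in> {0..1}"
        using x y by auto
      \<comment> \<open>Both bounds carry the same weight \<open>t\<close>, as the exchange by WM7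
        below requires.\<close>
      have "g x \<le> N (g (1 - y)) (g y) t" "g (1 - x) \<le> N (g y) (g (1 - y)) t"
        unfolding g_def
        using conv[OF M_in M_in t] affine mem comb by metis+
      then have "h x \<le> N (N (g (1 - y)) (g y) t) (N (g y) (g (1 - y)) t) (1/2)"
        unfolding h_def using N.mono_both g_pos mem by simp
      \<comment> \<open>WM7 exchanges the weights \<open>t\<close> and \<open>1/2\<close>, so that
        each inner mean pairs \<open>g (1 - y)\<close> with \<open>g y\<close>. Since
        \<open>h (1 - y) = h y\<close>, WM2 then removes the outer mean.\<close>
      also have "\<dots> = N (h (1 - y)) (h y) t"
        unfolding h_def using N.WM7 g_pos mem t by simp
      also have "\<dots> = h y"
        using h_sym[of y] N.WM2[of "h y" t] N.pos[of "g y" "g (1 - y)" "1/2"] g_pos mem t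
        by (simp add: h_def)
      finally show ?thesis .
    qed
  qed
  then have int: "h integrable_on {0..1}"
    using h_sym by (rule integrable_on_symmetric_mono)

  have lower: "f (M u v (1/2)) \<le> h l" if "l \<in> {0..1}" for l
  proof -
    \<comment> \<open>Convexity at weight \<open>1/2\<close>, between two points whose
      \<open>M\<close>-midpoint does not depend on \<open>l\<close>.\<close>
    have "f (M (M u v l) (M u v (1 - l)) (1/2)) \<le> h l"
      unfolding h_def g_def using conv M_in that by simp
    then show ?thesis using M.midpoint[OF u v that] by simp
  qed
  have upper: "h l \<le> N (f u) (f v) (1/2)" if "l \<in> {0..1}" for l
  proof -
    \<comment> \<open>Convexity between \<open>u\<close> and \<open>v\<close> at the weights
      \<open>l\<close> and \<open>1 - l\<close>; the midpoint identity for \<open>N\<close> then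
      eliminates \<open>l\<close>.\<close>
    have "h l \<le> N (N (f u) (f v) l) (N (f u) (f v) (1 - l)) (1/2)"
      unfolding h_def using N.mono_both conv[OF \<open>u \<in> I\<close> \<open>v \<in> I\<close>] g_pos that
      by (simp add: g_def)
    then show ?thesis using N.midpoint[of "f u" "f v" l] f_pos assms(10,11) that by simp
  qed
  have "f (M u v (1/2)) \<le> integral {0..1} h" "integral {0..1} h \<le> N (f u) (f v) (1/2)"
    using integral_le[OF integrable_const_ivl int lower] integral_le[OF int integrable_const_ivl upper]
    by auto
  then show ?thesis
    using int unfolding h_def g_def by blast
qed

end
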